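(* Suppose the linear program $P:\ \min\{\mathbf c^T\mathbf x\mid\mathbf A\mathbf x=\mathbf b,\ \mathbf x\ge\mathbf 0\}$ is generated according to Generative Model 2 (defined in the context). Let $\boldsymbol\xi$ be the uniform distribution over $[n]$, i.e., $\xi_j=1/n$ for all $j\in[n]$. Let $t\ge1$ and suppose that $n>4\pi t^2m$. Set $$C=\|\mathbf b\|_2\cdot\frac{1}{\frac{\sqrt2}{2\sqrt\pi}-\frac{t\sqrt{2m}}{\sqrt n}}.$$ Then, with probability at least $1-1/t$, both $P$ and $P_{\mathrm{distr}}$ are feasible, and $$\Delta v(P_{\mathrm{distr}})\le\frac{\|\mathbf b\|_2}{\sqrt n}\cdot\frac{1}{\frac{\sqrt2}{2\sqrt\pi}-\frac{t\sqrt{2m}}{\sqrt n}}.$$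
   Context: Generative Model 2 produces $(\mathbf A,\mathbf b,\mathbf c)$ as follows: (1) fix any $\mathbf b\in\mathbb R^m$; (2) generate $n$ i.i.d. random vectors $\mathbf A_1,\dots,\mathbf A_n\sim\mathrm{Normal}(\mathbf 0,\mathbf I)$, the standard multivariate normal distribution on $\mathbb R^m$; (3) set $\mathbf A=[\mathbf A_1\cdots\mathbf A_n]$; (4) if $\{\mathbf x\mid\mathbf A\mathbf x=\mathbf b,\mathbf x\ge\mathbf 0\}$ is non-empty, fix any $\mathbf c\in\mathbb R^n$ with $\|\mathbf c\|_2=1$ such that $v(P)\ge0$; otherwise fix any $\mathbf c\in\mathbb R^n$ with $\|\mathbf c\|_2=1$ ($\mathbf c$ is chosen after $\mathbf A$ and $\mathbf b$ and may depend on them; the manner of choice is otherwise arbitrary). $P_{\mathrm{distr}}:\ \min\{\mathbf c^T\mathbf x\mid\mathbf A\mathbf x=\mathbf b,\ \mathbf 0\le\mathbf x\le C\boldsymbol\xi\}$. $v(\cdot)$ denotes the optimal value and $\Delta v(P_{\mathrm{distr}})=v(P_{\mathrm{distr}})-v(P)$. $[n]=\{1,\dots,n\}$. *)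

theory Defs
  imports "HOL-Probability.Probability"
begin

text \<open>
  On \<^typ>\<open>real ^ 'n\<close> the order \<open>\<le>\<close> is componentwise and \<^const>\<open>norm\<close> is the Euclidean norm.
\<close>

definition feasible_P :: "real ^ 'n ^ 'm \<Rightarrow> real ^ 'm \<Rightarrow> (real ^ 'n) set" where
  "feasible_P A b = {x. A *v x = b \<and> 0 \<le> x}"

definition feasible_P_distr ::
    "real ^ 'n ^ 'm \<Rightarrow> real ^ 'm \<Rightarrow> real \<Rightarrow> real ^ 'n \<Rightarrow> (real ^ 'n) set" where
  "feasible_P_distr A b C \<xi> = {x. A *v x = b \<and> 0 \<le> x \<and> x \<le> C *\<^sub>R \<xi>}"

text \<open>
  Optimal value of \<open>min {c\<^sup>T x | x \<in> S}\<close>, as an extended real: \<open>\<infinity>\<close> if the program is infeasible,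
  \<open>-\<infinity>\<close> if it is unbounded below.
\<close>

definition opt_value :: "real ^ 'n \<Rightarrow> (real ^ 'n) set \<Rightarrow> ereal" where
  "opt_value c S = (INF x\<in>S. ereal (c \<bullet> x))"

definition v_P :: "real ^ 'n ^ 'm \<Rightarrow> real ^ 'm \<Rightarrow> real ^ 'n \<Rightarrow> ereal" where
  "v_P A b c = opt_value c (feasible_P A b)"

definition v_P_distr ::
    "real ^ 'n ^ 'm \<Rightarrow> real ^ 'm \<Rightarrow> real ^ 'n \<Rightarrow> real \<Rightarrow> real ^ 'n \<Rightarrow> ereal" where
  "v_P_distr A b c C \<xi> = opt_value c (feasible_P_distr A b C \<xi>)"

definition delta_v_P_distr ::
    "real ^ 'n ^ 'm \<Rightarrow> real ^ 'm \<Rightarrow> real ^ 'n \<Rightarrow> real \<Rightarrow> real ^ 'n \<Rightarrow> ereal" where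
  "delta_v_P_distr A b c C \<xi> = v_P_distr A b c C \<xi> - v_P A b c"

text \<open>Density of \<open>Normal(0, I)\<close> on \<open>\<real>\<^sup>m\<close> with respect to Lebesgue measure.\<close>

definition std_mv_normal_density :: "real ^ 'm \<Rightarrow> real" where
  "std_mv_normal_density x = 1 / sqrt (2 * pi) ^ CARD('m) * exp (- (norm x)\<^sup>2 / 2)"

text \<open>
  The cost vector \<open>c\<close> is an arbitrary function of the outcome, so it may depend on \<open>A\<close> and \<open>b\<close>
  (and on further randomness) in any way; in particular it need not be measurable.
\<close>

definition generative_model_2 ::
    "'w measure \<Rightarrow> real ^ 'm \<Rightarrow> ('w \<Rightarrow> real ^ 'n ^ 'm) \<Rightarrow> ('w \<Rightarrow> real ^ 'n) \<Rightarrow> bool" where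
  "generative_model_2 M b A c \<longleftrightarrow>
     prob_space M \<and>
     prob_space.indep_vars M (\<lambda>_. borel) (\<lambda>j \<omega>. column j (A \<omega>)) UNIV \<and>
     (\<forall>j. distributed M lborel (\<lambda>\<omega>. column j (A \<omega>)) (\<lambda>x. ennreal (std_mv_normal_density x))) \<and>
     (\<forall>\<omega>\<in>space M. norm (c \<omega>) = 1 \<and>
        (feasible_P (A \<omega>) b \<noteq> {} \<longrightarrow> 0 \<le> v_P (A \<omega>) b (c \<omega>)))"

text \<open>
  \<open>Q\<close> holds with probability at least \<open>p\<close>: some event of probability at least \<open>p\<close> is contained in
  \<open>{\<omega>. Q \<omega>}\<close>. If that set is itself an event, this says exactly that its probability is at
  least \<open>p\<close>; otherwise (possible for non-measurable \<open>c\<close>) it bounds its inner probability.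
\<close>

definition with_prob_at_least :: "'w measure \<Rightarrow> real \<Rightarrow> ('w \<Rightarrow> bool) \<Rightarrow> bool" where
  "with_prob_at_least M p Q \<longleftrightarrow> (\<exists>E\<in>sets M. p \<le> measure M E \<and> (\<forall>\<omega>\<in>E. Q \<omega>))"

end

theory Submission
  imports Defs
begin

text \<open>
  If \<open>A x = b\<close> has a solution with all entries in \<open>[0, C / n]\<close>, then its cost is at most its
  Euclidean norm, hence at most \<open>C / sqrt n\<close>, and the gap bound follows from \<open>v(P) \<ge> 0\<close>. By
  separation, such a solution exists as soon as the support function of the zonotope
  \<open>A ` [0, C / n]\<^sup>n\<close> dominates \<open>norm b\<close> on the unit sphere, that is, as soon as the averages over
  \<open>j\<close> of \<open>max 0 (y \<bullet> A\<^sub>j)\<close> are, uniformly in unit vectors \<open>y\<close>, not much smaller than their mean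
  \<open>1 / sqrt (2 * pi)\<close>. Symmetrization and contraction, carried out one column at a time, bound the
  expected supremum over \<open>y\<close> of the sum of the deficits by \<open>sqrt (2 * m * n)\<close>, and Markov's
  inequality concludes. To stay measurable, the supremum is first taken over finite sets of \<open>y\<close>.
\<close>

section \<open>The standard Gaussian measure: marginals, independence, moments and symmetry\<close>

abbreviation std_gaussian :: "(real ^ 'm) measure" where
  "std_gaussian \<equiv> density lborel (\<lambda>x. ennreal (std_mv_normal_density x))"

lemma borel_measurable_std_mv_normal_density [measurable]:
  "std_mv_normal_density \<in> borel_measurable borel"
  unfolding std_mv_normal_density_def [abs_def] by measurable

lemma std_mv_normal_density_eq_prod:
  fixes x :: "real ^ 'm"
  shows "std_mv_normal_density x = (\<Prod>b\<in>Basis. std_normal_density (x \<bullet> b))"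
proof -
  have "(norm x)\<^sup>2 = (\<Sum>b\<in>Basis. (x \<bullet> b)\<^sup>2)"
    by (simp add: norm_eq_sqrt_inner power2_eq_square) (rule euclidean_inner)
  then show ?thesis
    by (simp add: std_mv_normal_density_def std_normal_density_def prod.distrib prod_dividef
        sum_divide_distrib exp_sum flip: sum_negf)
qed

text \<open>Both the density and the indicator of the box factor over the coordinates, so Tonelli
  splits the integral. Total mass, marginals and independence of the coordinates are all read off
  from this formula by choosing the sides \<open>S b\<close>.\<close>

lemma emeasure_std_gaussian_box:
  fixes S :: "real ^ 'm \<Rightarrow> real set"
  assumes [measurable]: "\<And>b. b \<in> Basis \<Longrightarrow> S b \<in> sets borel"
  shows "emeasure std_gaussian {x. \<forall>b\<in>Basis. x \<bullet> b \<in> S b} =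
    (\<Prod>b\<in>Basis. emeasure std_normal_distribution (S b))"
proof -
  let ?B = "{x :: real ^ 'm. \<forall>b\<in>Basis. x \<bullet> b \<in> S b}"
  have "?B = (\<Inter>b\<in>Basis. {x. x \<bullet> b \<in> S b})" by auto
  moreover have "{x. x \<bullet> b \<in> S b} \<in> sets borel" if b: "b \<in> Basis" for b :: "real ^ 'm"
    using measurable_sets_borel [OF _ assms [OF b], of "\<lambda>x. x \<bullet> b"] by (simp add: vimage_def)
  ultimately have [measurable]: "?B \<in> sets borel"
    by (auto intro: sets.finite_INT)
  have ind: "indicator ?B x = (\<Prod>b\<in>Basis. indicator (S b) (x \<bullet> b) :: real)" for x
  proof (cases "x \<in> ?B")
    case False
    then have "(\<Prod>b\<in>Basis. indicator (S b) (x \<bullet> b) :: real) = 0"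
      by (intro prod_zero) (auto simp: indicator_def)
    with False show ?thesis by simp
  qed simp
  have "emeasure std_gaussian ?B = (\<integral>\<^sup>+ x. ennreal (std_mv_normal_density x) * indicator ?B x \<partial>lborel)"
    by (rule emeasure_density) auto
  also have "\<dots> = (\<integral>\<^sup>+ x. ennreal (\<Prod>b\<in>Basis. std_normal_density (x \<bullet> b) * indicator (S b) (x \<bullet> b)) \<partial>lborel)"
    by (rule nn_integral_cong) (simp add: std_mv_normal_density_eq_prod prod.distrib prod_nonneg ennreal_mult flip: ind ennreal_indicator)
  also have "\<dots> = (\<integral>\<^sup>+ x. (\<Prod>b\<in>Basis. ennreal (std_normal_density (x \<bullet> b) * indicator (S b) (x \<bullet> b))) \<partial>lborel)"
    by (rule nn_integral_cong) (simp add: prod_ennreal)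
  also have "\<dots> = (\<Prod>b\<in>Basis. \<integral>\<^sup>+ x. ennreal (std_normal_density x * indicator (S b) x) \<partial>lborel)"
    by (rule nn_integral_lborel_prod [of "\<lambda>b x. std_normal_density x * indicator (S b) x"]) auto
  also have "\<dots> = (\<Prod>b\<in>Basis. emeasure std_normal_distribution (S b))"
    by (rule prod.cong) (auto simp: emeasure_density ennreal_mult'' ennreal_indicator)
  finally show ?thesis .
qed

lemma prob_space_std_gaussian: "prob_space (std_gaussian :: (real ^ 'm) measure)"
proof
  have "emeasure std_gaussian (space (std_gaussian :: (real ^ 'm) measure)) =
      emeasure std_gaussian {x :: real ^ 'm. \<forall>b\<in>Basis. x \<bullet> b \<in> UNIV}"
    by simp
  also have "\<dots> = 1"
    using prob_space.emeasure_space_1 [OF prob_space_normal_density [of 1 0]]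
    by (subst emeasure_std_gaussian_box) auto
  finally show "emeasure std_gaussian (space (std_gaussian :: (real ^ 'm) measure)) = 1" .
qed

lemma distr_std_gaussian_coordinate:
  assumes b: "(b :: real ^ 'm) \<in> Basis"
  shows "distr std_gaussian borel (\<lambda>x. x \<bullet> b) = std_normal_distribution"
proof (rule measure_eqI)
  fix T assume "T \<in> sets (distr (std_gaussian :: (real ^ 'm) measure) borel (\<lambda>x. x \<bullet> b))"
  then have T [measurable]: "T \<in> sets borel" by simp
  let ?S = "\<lambda>c. if c = b then T else UNIV"
  have "emeasure (distr std_gaussian borel (\<lambda>x. x \<bullet> b)) T = emeasure std_gaussian {x. x \<bullet> b \<in> T}"
    by (subst emeasure_distr) (auto simp: vimage_def)
  also have "{x. x \<bullet> b \<in> T} = {x. \<forall>c\<in>Basis. x \<bullet> c \<in> ?S c}"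
    using b by auto
  also have "emeasure std_gaussian \<dots> =
      (\<Prod>c\<in>Basis. emeasure std_normal_distribution (?S c))"
    by (rule emeasure_std_gaussian_box) auto
  also have "\<dots> = emeasure std_normal_distribution T"
    using b prob_space.emeasure_space_1 [OF prob_space_normal_density [of 1 0]]
    by (subst prod.remove [of _ b]) (auto intro!: prod.neutral)
  finally show "emeasure (distr std_gaussian borel (\<lambda>x. x \<bullet> b)) T =
    emeasure std_normal_distribution T" .
qed simp

lemma indep_coordinates_std_gaussian:
  "prob_space.indep_vars (std_gaussian :: (real ^ 'm) measure) (\<lambda>_. borel) (\<lambda>b x. x \<bullet> b) Basis"
proof -
  interpret prob_space "std_gaussian :: (real ^ 'm) measure"
    by (rule prob_space_std_gaussian)
  let ?N = "std_normal_distribution"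
  interpret N: prob_space ?N
    by (rule prob_space_normal_density) simp
  interpret N: product_prob_space "\<lambda>_ :: real ^ 'm. ?N" Basis
    by unfold_locales
  have "distr std_gaussian (PiM Basis (\<lambda>_. borel)) (\<lambda>x. \<lambda>b\<in>Basis. x \<bullet> b) = PiM (Basis :: (real ^ 'm) set) (\<lambda>_. ?N)"
  proof (rule N.PiM_eqI)
    fix S :: "real ^ 'm \<Rightarrow> real set" assume "\<And>b. b \<in> Basis \<Longrightarrow> S b \<in> sets ?N"
    then have S [measurable]: "\<And>b. b \<in> Basis \<Longrightarrow> S b \<in> sets borel" by simp
    have "emeasure (distr std_gaussian (PiM Basis (\<lambda>_. borel)) (\<lambda>x. \<lambda>b\<in>Basis. x \<bullet> b)) (Pi\<^sub>E Basis S) =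
        emeasure std_gaussian {x. \<forall>b\<in>Basis. x \<bullet> b \<in> S b}"
      by (subst emeasure_distr) (auto intro!: sets_PiM_I_finite arg_cong [where f = "emeasure _"])
    then show "emeasure (distr std_gaussian (PiM Basis (\<lambda>_. borel)) (\<lambda>x. \<lambda>b\<in>Basis. x \<bullet> b)) (Pi\<^sub>E Basis S) =
        (\<Prod>b\<in>Basis. emeasure ?N (S b))"
      by (simp add: emeasure_std_gaussian_box S)
  qed (auto intro!: sets_PiM_cong)
  also have "PiM (Basis :: (real ^ 'm) set) (\<lambda>_. ?N) = PiM Basis (\<lambda>b. distr std_gaussian borel (\<lambda>x. x \<bullet> b))"
    by (rule PiM_cong) (auto simp: distr_std_gaussian_coordinate)
  finally show ?thesis
    by (subst indep_vars_iff_distr_eq_PiM) auto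
qed

text \<open>Sums of independent normal variables are normal and their variances add up, here to the
  sum of the squares of \<open>y \<bullet> b\<close>.\<close>

lemma distributed_inner_std_gaussian:
  fixes y :: "real ^ 'm"
  assumes "y \<noteq> 0"
  shows "distributed std_gaussian lborel (\<lambda>x. y \<bullet> x) (normal_density 0 (norm y))"
proof -
  interpret prob_space "std_gaussian :: (real ^ 'm) measure"
    by (rule prob_space_std_gaussian)
  \<comment> \<open>Coordinates with \<open>y \<bullet> b = 0\<close> contribute a constant, which
    has no normal density; they are dropped before the summation rule for normal variables is
    applied.\<close>
  define I where "I = {b \<in> Basis. y \<bullet> b \<noteq> 0}"
  have I: "finite I" "I \<subseteq> Basis" "I \<noteq> {}"
    using assms euclidean_all_zero_iff [of y] by (auto simp: I_def)
  have coord: "distributed std_gaussian lborel (\<lambda>x. x \<bullet> b) std_normal_density" if "b \<in> Basis" for b :: "real ^ 'm"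
    using distr_std_gaussian_coordinate [OF that] by (simp add: distributed_def cong: distr_cong)
  have "indep_vars (\<lambda>_. borel) (\<lambda>b x. (y \<bullet> b) * (x \<bullet> b)) I"
    by (rule indep_vars_compose2 [OF indep_vars_subset [OF indep_coordinates_std_gaussian I(2)]]) auto
  moreover have "distributed std_gaussian lborel (\<lambda>x. (y \<bullet> b) * (x \<bullet> b)) (normal_density 0 \<bar>y \<bullet> b\<bar>)"
    if "b \<in> I" for b
    using normal_density_affine [OF coord, of b "y \<bullet> b" 0] that I(2) by (auto simp: I_def)
  ultimately have "distributed std_gaussian lborel (\<lambda>x. \<Sum>b\<in>I. (y \<bullet> b) * (x \<bullet> b))
      (normal_density (\<Sum>b\<in>I. 0) (sqrt (\<Sum>b\<in>I. \<bar>y \<bullet> b\<bar>\<^sup>2)))"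
    by (intro sum_indep_normal) (use I in \<open>auto simp: I_def\<close>)
  moreover have "(\<Sum>b\<in>I. (y \<bullet> b) * (x \<bullet> b)) = y \<bullet> x" for x
    unfolding euclidean_inner [of y x] by (rule sum.mono_neutral_left) (auto simp: I_def)
  moreover have "sqrt (\<Sum>b\<in>I. \<bar>y \<bullet> b\<bar>\<^sup>2) = norm y"
    unfolding norm_eq_sqrt_inner euclidean_inner [of y y]
    by (rule arg_cong [where f = sqrt], rule sum.mono_neutral_cong_left)
       (auto simp: I_def power2_eq_square)
  ultimately show ?thesis by simp
qed

lemma std_gaussian_abs_inner:
  fixes y :: "real ^ 'm"
  shows "integrable std_gaussian (\<lambda>x. \<bar>y \<bullet> x\<bar>)"
    and "(\<integral>x. \<bar>y \<bullet> x\<bar> \<partial>std_gaussian) = sqrt (2 / pi) * norm y"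
proof -
  have "has_bochner_integral std_gaussian (\<lambda>x. \<bar>y \<bullet> x\<bar>) (sqrt (2 / pi) * norm y)"
  proof (cases "y = 0")
    case False
    have "has_bochner_integral lborel (\<lambda>x. normal_density 0 (norm y) x * \<bar>x\<bar>) (norm y * sqrt (2 / pi))"
      using normal_moment_abs_odd [of "norm y" 0 0] False by simp
    then show ?thesis
      using distributed_integrable [OF distributed_inner_std_gaussian [OF False], of abs]
        distributed_integral [OF distributed_inner_std_gaussian [OF False], of abs]
      by (simp add: has_bochner_integral_iff mult.commute)
  qed (simp add: has_bochner_integral_zero)
  then show "integrable std_gaussian (\<lambda>x. \<bar>y \<bullet> x\<bar>)"
    and "(\<integral>x. \<bar>y \<bullet> x\<bar> \<partial>std_gaussian) = sqrt (2 / pi) * norm y"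
    by (simp_all add: has_bochner_integral_iff)
qed

text \<open>Each coordinate has second moment \<open>1\<close>. This is the source of the dimension
  factor in the final bound.\<close>

lemma std_gaussian_norm_sq:
  shows "integrable std_gaussian (\<lambda>x :: real ^ 'm. (norm x)\<^sup>2)"
    and "(\<integral>x. (norm x)\<^sup>2 \<partial>(std_gaussian :: (real ^ 'm) measure)) = real CARD('m)"
proof -
  have "has_bochner_integral std_gaussian (\<lambda>x. (b \<bullet> x)\<^sup>2) 1" if "b \<in> Basis" for b :: "real ^ 'm"
  proof -
    have b: "b \<noteq> 0" "norm b = 1" using that by auto
    have "has_bochner_integral lborel (\<lambda>x. std_normal_density x * x\<^sup>2) 1"
      using normal_moment_even [of 1 0 1] by simp
    then show ?thesis
      using distributed_integrable [OF distributed_inner_std_gaussian [OF b(1)], of "\<lambda>x. x\<^sup>2"]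
        distributed_integral [OF distributed_inner_std_gaussian [OF b(1)], of "\<lambda>x. x\<^sup>2"] b(2)
      by (simp add: has_bochner_integral_iff)
  qed
  then have "has_bochner_integral std_gaussian (\<lambda>x :: real ^ 'm. \<Sum>b\<in>Basis. (b \<bullet> x)\<^sup>2) (\<Sum>b\<in>(Basis :: (real ^ 'm) set). 1)"
    by (rule has_bochner_integral_sum)
  moreover have "(\<Sum>b\<in>Basis. (b \<bullet> x)\<^sup>2) = (norm x)\<^sup>2" for x :: "real ^ 'm"
    unfolding power2_norm_eq_inner euclidean_inner [of x x] by (simp add: power2_eq_square inner_commute)
  ultimately show "integrable std_gaussian (\<lambda>x :: real ^ 'm. (norm x)\<^sup>2)"
    and "(\<integral>x. (norm x)\<^sup>2 \<partial>(std_gaussian :: (real ^ 'm) measure)) = real CARD('m)"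
    by (simp_all add: has_bochner_integral_iff)
qed

text \<open>Lebesgue measure and the density are both even; for the former, the affine change of
  variables with scaling \<open>-1\<close> in every coordinate has Jacobian of absolute value
  \<open>1\<close>.\<close>

lemma distr_uminus_std_gaussian:
  "distr std_gaussian borel uminus = (std_gaussian :: (real ^ 'm) measure)"
proof -
  have "lborel = (density (distr lborel borel uminus) (\<lambda>_. 1) :: (real ^ 'm) measure)"
    using lborel_affine_euclidean [of "\<lambda>_. -1" "0 :: real ^ 'm"]
    by (simp add: sum_negf euclidean_representation)
  then have *: "distr lborel borel uminus = (lborel :: (real ^ 'm) measure)"
    by (simp add: density_1)
  have "(std_gaussian :: (real ^ 'm) measure) = density (distr lborel borel uminus) (\<lambda>x. ennreal (std_mv_normal_density x))"
    by (simp add: * )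
  also have "\<dots> = distr std_gaussian borel (uminus :: real ^ 'm \<Rightarrow> _)"
    by (subst density_distr) (auto simp: std_mv_normal_density_def)
  finally show ?thesis by simp
qed

lemma integral_std_gaussian_uminus:
  fixes f :: "real ^ 'm \<Rightarrow> real"
  assumes "f \<in> borel_measurable borel"
  shows "(\<integral>x. f (- x) \<partial>std_gaussian) = (\<integral>x. f x \<partial>std_gaussian)"
  using integral_distr [of uminus "std_gaussian :: (real ^ 'm) measure" borel f] assms
  by (simp add: distr_uminus_std_gaussian)

lemma integrable_std_gaussian_inner:
  fixes y :: "real ^ 'm"
  shows "integrable std_gaussian (\<lambda>x. y \<bullet> x)"
  by (rule integrable_norm_cancel) (use std_gaussian_abs_inner in auto)

lemma integral_std_gaussian_inner:
  fixes y :: "real ^ 'm"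
  shows "(\<integral>x. y \<bullet> x \<partial>std_gaussian) = 0"
  using integral_std_gaussian_uminus [of "\<lambda>x. y \<bullet> x"] by simp

lemma integrable_std_gaussian_relu:
  fixes y :: "real ^ 'm"
  shows "integrable std_gaussian (\<lambda>x. max 0 (y \<bullet> x))"
  by (intro integrable_max integrable_std_gaussian_inner) simp

text \<open>Since \<open>max 0 s = (s + \<bar>s\<bar>) / 2\<close> and the linear part has mean
  zero, the value is half of the first absolute moment.\<close>

lemma integral_std_gaussian_relu:
  fixes y :: "real ^ 'm"
  shows "(\<integral>x. max 0 (y \<bullet> x) \<partial>std_gaussian) = norm y / sqrt (2 * pi)"
proof -
  have "(\<integral>x. max 0 (y \<bullet> x) \<partial>std_gaussian) = (\<integral>x. (y \<bullet> x + \<bar>y \<bullet> x\<bar>) / 2 \<partial>std_gaussian)"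
    by (rule Bochner_Integration.integral_cong) auto
  also have "\<dots> = sqrt (2 / pi) * norm y / 2"
    by (simp add: std_gaussian_abs_inner integrable_std_gaussian_inner integral_std_gaussian_inner)
  also have "sqrt (2 / pi) = 2 / sqrt (2 * pi)"
    by (simp add: real_sqrt_divide real_sqrt_mult field_simps)
  finally show ?thesis by simp
qed

section \<open>Symmetrization and contraction for a single column\<close>

text \<open>This is the contraction principle for Rademacher averages, applied to a single sign.\<close>

lemma MAX_abs_contraction:
  fixes h x :: "'a \<Rightarrow> real"
  assumes "finite F" "F \<noteq> {}"
  shows "(MAX y\<in>F. h y + \<bar>x y\<bar>) + (MAX y\<in>F. h y - \<bar>x y\<bar>) \<le>
    (MAX y\<in>F. h y + x y) + (MAX y\<in>F. h y - x y)"
proof -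
  have "(MAX y\<in>F. h y + \<bar>x y\<bar>) \<in> (\<lambda>y. h y + \<bar>x y\<bar>) ` F" "(MAX y\<in>F. h y - \<bar>x y\<bar>) \<in> (\<lambda>y. h y - \<bar>x y\<bar>) ` F"
    using assms by (auto intro!: Max_in)
  then obtain u v where uv: "u \<in> F" "v \<in> F"
    "(MAX y\<in>F. h y + \<bar>x y\<bar>) = h u + \<bar>x u\<bar>" "(MAX y\<in>F. h y - \<bar>x y\<bar>) = h v - \<bar>x v\<bar>"
    by auto
  have "h y + x y \<le> (MAX y\<in>F. h y + x y)" "h y - x y \<le> (MAX y\<in>F. h y - x y)" if "y \<in> F" for y
    using assms that by (auto intro!: Max_ge)
  from this [OF uv(1)] this [OF uv(2)] show ?thesis
    unfolding uv(3,4) by linarith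
qed

text \<open>
  Jensen's inequality replaces the mean \<open>norm y / sqrt (2 * pi)\<close> of \<open>max 0 (y \<bullet> a)\<close> by an independent
  copy. Then \<open>2 * max 0 x = x + \<bar>x\<bar>\<close>, and by symmetry of the Gaussian the sign of \<open>x\<close> is independent
  of the symmetrizing sign in front of \<open>\<bar>x\<bar>\<close>, so that after contraction the two signs add up in
  quadrature. This is where the factor \<open>sqrt 2\<close>, instead of \<open>2\<close>, comes from.
\<close>

lemma std_gaussian_MAX_step:
  fixes h :: "real ^ 'm \<Rightarrow> real"
  assumes F: "finite F" "F \<noteq> {}"
  shows "(\<integral>a. (MAX y\<in>F. h y + (norm y / sqrt (2 * pi) - max 0 (y \<bullet> a))) \<partial>std_gaussian) \<le>
    ((MAX y\<in>F. h y) + (\<integral>a. (MAX y\<in>F. h y + 2 * (y \<bullet> a)) \<partial>std_gaussian)) / 2"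
proof -
  interpret prob_space "std_gaussian :: (real ^ 'm) measure"
    by (rule prob_space_std_gaussian)
  have [simp]: "measure std_gaussian (UNIV :: (real ^ 'm) set) = 1"
    using prob_space by simp
  note [simp] = integrable_std_gaussian_relu std_gaussian_abs_inner(1) integrable_std_gaussian_inner
  let ?R = "\<lambda>a. MAX y\<in>F. h y + 2 * max 0 (y \<bullet> a)"
  let ?S = "\<lambda>a. MAX y\<in>F. h y - 2 * max 0 (y \<bullet> a)"
  have int: "integrable std_gaussian (\<lambda>a. MAX y\<in>F. f y a)"
    if "\<And>y. integrable std_gaussian (f y)" for f :: "real ^ 'm \<Rightarrow> real ^ 'm \<Rightarrow> real"
    using F that by (intro integrable_MAX) auto
  have intR: "integrable std_gaussian ?R" and intS: "integrable std_gaussian ?S"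
    by (rule int; simp)+
  \<comment> \<open>With \<open>p\<close> the mean and \<open>q = max 0 (y \<bullet> a)\<close>, the
    term \<open>h y + (p - q)\<close> is the average of \<open>h y + 2 * p\<close> and
    \<open>h y - 2 * q\<close>. This bounds the maximum by the average of \<open>?H\<close> and
    \<open>?S a\<close>, and \<open>?H\<close> is a maximum of expectations, hence at most the
    expectation of the maximum \<open>?R\<close>.\<close>
  let ?H = "MAX y\<in>F. h y + 2 * (norm y / sqrt (2 * pi))"
  have H: "?H \<le> (\<integral>a. ?R a \<partial>std_gaussian)"
  proof (intro Max.boundedI)
    fix r assume "r \<in> (\<lambda>y. h y + 2 * (norm y / sqrt (2 * pi))) ` F"
    then obtain y where y: "y \<in> F" "r = h y + 2 * (norm y / sqrt (2 * pi))" by auto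
    then have "r = (\<integral>a. h y + 2 * max 0 (y \<bullet> a) \<partial>std_gaussian)"
      by (simp add: integral_std_gaussian_relu)
    also have "\<dots> \<le> (\<integral>a. ?R a \<partial>std_gaussian)"
      by (rule integral_mono [OF _ intR]) (use F y in \<open>auto intro!: Max_ge\<close>)
    finally show "r \<le> (\<integral>a. ?R a \<partial>std_gaussian)" .
  qed (use F in auto)
  have "(\<integral>a. (MAX y\<in>F. h y + (norm y / sqrt (2 * pi) - max 0 (y \<bullet> a))) \<partial>std_gaussian) \<le>
      (\<integral>a. (?H + ?S a) / 2 \<partial>std_gaussian)"
  proof (rule integral_mono)
    fix a :: "real ^ 'm"
    show "(MAX y\<in>F. h y + (norm y / sqrt (2 * pi) - max 0 (y \<bullet> a))) \<le> (?H + ?S a) / 2"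
    proof (intro Max.boundedI)
      fix r assume "r \<in> (\<lambda>y. h y + (norm y / sqrt (2 * pi) - max 0 (y \<bullet> a))) ` F"
      then obtain y where y: "y \<in> F" "r = h y + (norm y / sqrt (2 * pi) - max 0 (y \<bullet> a))" by auto
      have "h y + 2 * (norm y / sqrt (2 * pi)) \<le> ?H" "h y - 2 * max 0 (y \<bullet> a) \<le> ?S a"
        using F y(1) by (auto intro!: Max_ge)
      then show "r \<le> (?H + ?S a) / 2"
        unfolding y(2) by argo
    qed (use F in auto)
  qed (auto intro!: int intS)
  also have "\<dots> = (?H + (\<integral>a. ?S a \<partial>std_gaussian)) / 2"
    using intS by simp
  also have "\<dots> \<le> ((\<integral>a. ?R a \<partial>std_gaussian) + (\<integral>a. ?S a \<partial>std_gaussian)) / 2"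
    using H by simp
  \<comment> \<open>Only \<open>?S\<close> is reflected. With \<open>s = y \<bullet> a\<close>, the
    reflected term is \<open>h y - 2 * max 0 (- s) = (h y + s) - \<bar>s\<bar>\<close>, while the
    term in \<open>?R\<close> is \<open>(h y + s) + \<bar>s\<bar>\<close>: both now share the base
    \<open>h y + s\<close> that the contraction needs.\<close>
  also have "(\<integral>a. ?S a \<partial>std_gaussian) = (\<integral>a. ?S (- a) \<partial>std_gaussian)"
    by (rule integral_std_gaussian_uminus [symmetric]) (use borel_measurable_integrable [OF intS] in simp)
  also have "\<dots> = (\<integral>a. (MAX y\<in>F. (h y + y \<bullet> a) - \<bar>y \<bullet> a\<bar>) \<partial>std_gaussian)"
    by (intro Bochner_Integration.integral_cong arg_cong [where f = Max] image_cong) auto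
  also have "(\<integral>a. ?R a \<partial>std_gaussian) = (\<integral>a. (MAX y\<in>F. (h y + y \<bullet> a) + \<bar>y \<bullet> a\<bar>) \<partial>std_gaussian)"
    by (intro Bochner_Integration.integral_cong arg_cong [where f = Max] image_cong) auto
  also have "\<dots> + (\<integral>a. (MAX y\<in>F. (h y + y \<bullet> a) - \<bar>y \<bullet> a\<bar>) \<partial>std_gaussian) =
      (\<integral>a. (MAX y\<in>F. (h y + y \<bullet> a) + \<bar>y \<bullet> a\<bar>) + (MAX y\<in>F. (h y + y \<bullet> a) - \<bar>y \<bullet> a\<bar>) \<partial>std_gaussian)"
    by (rule Bochner_Integration.integral_add [symmetric]; rule int; simp)
  \<comment> \<open>After contraction the two occurrences of \<open>y \<bullet> a\<close> either
    double or cancel, which leaves \<open>h y + 2 * (y \<bullet> a)\<close> and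
    \<open>h y\<close>.\<close>
  also have "\<dots> \<le> (\<integral>a. (MAX y\<in>F. (h y + y \<bullet> a) + y \<bullet> a) + (MAX y\<in>F. (h y + y \<bullet> a) - y \<bullet> a) \<partial>std_gaussian)"
    by (rule integral_mono; (rule MAX_abs_contraction [OF F] | intro Bochner_Integration.integrable_add int)) auto
  also have "\<dots> = (\<integral>a. (MAX y\<in>F. h y) + (MAX y\<in>F. h y + 2 * (y \<bullet> a)) \<partial>std_gaussian)"
    by (simp add: algebra_simps)
  also have "\<dots> = (MAX y\<in>F. h y) + (\<integral>a. (MAX y\<in>F. h y + 2 * (y \<bullet> a)) \<partial>std_gaussian)"
    by (subst Bochner_Integration.integral_add) (auto intro!: int)
  finally show ?thesis by simp
qed

section \<open>Expected supremum and tail bound of the deficit over finite sets of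
  directions\<close>

text \<open>For Gaussian \<open>x j\<close> every summand has mean zero. An upper bound on this
  quantity is a lower bound on the support function of the zonotope spanned by the
  \<open>x j\<close>. The index set \<open>J\<close> is a parameter so that columns can be added one
  at a time.\<close>

definition relu_deficit :: "'j set \<Rightarrow> ('j \<Rightarrow> real ^ 'm) \<Rightarrow> real ^ 'm \<Rightarrow> real" where
  "relu_deficit J x y = (\<Sum>j\<in>J. norm y / sqrt (2 * pi) - max 0 (y \<bullet> x j))"

lemma relu_deficit_zero [simp]: "relu_deficit J x 0 = 0"
  by (simp add: relu_deficit_def)

lemma relu_deficit_insert:
  assumes "finite J" "i \<notin> J"
  shows "relu_deficit (insert i J) (x(i := a)) y =
    relu_deficit J x y + (norm y / sqrt (2 * pi) - max 0 (y \<bullet> a))"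
  using assms by (auto simp: relu_deficit_def intro!: sum.cong)

lemma borel_measurable_relu_deficit [measurable]:
  "(\<lambda>x. relu_deficit J x y) \<in> borel_measurable (PiM J (\<lambda>_. std_gaussian))"
  unfolding relu_deficit_def by measurable

text \<open>With \<open>0\<close> among the directions the maxima are nonnegative, so that nothing
  is lost by passing to \<open>ennreal\<close>.\<close>

lemma MAX_nonneg:
  fixes f :: "'a \<Rightarrow> real"
  assumes "finite F" "y \<in> F" "f y = 0"
  shows "0 \<le> (MAX y\<in>F. f y)"
  using assms by (metis Max_ge finite_imageI imageI)

text \<open>
  The quadratic bound on the right, which for \<open>J = {}\<close> is AM-GM, is reproduced exactly by
  \<open>std_gaussian_MAX_step\<close>: averaging it over \<open>z\<close> and \<open>z + 2 *\<^sub>R a\<close> adds \<open>2 * CARD('m)\<close> to \<open>(norm z)\<^sup>2\<close>.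
\<close>

lemma nn_integral_MAX_relu_deficit_le:
  fixes F :: "(real ^ 'm) set" and z :: "real ^ 'm"
  assumes F: "finite F" "0 \<in> F" "F \<subseteq> cball 0 1" and L: "L > 0" and J: "finite J"
  shows "(\<integral>\<^sup>+ x. ennreal (MAX y\<in>F. y \<bullet> z + relu_deficit J x y) \<partial>PiM J (\<lambda>_. std_gaussian)) \<le>
    ennreal (((norm z)\<^sup>2 + 2 * real CARD('m) * real (card J)) / (2 * L) + L / 2)"
  using J
proof (induction J arbitrary: z rule: finite_induct)
  case empty
  have "(MAX y\<in>F. y \<bullet> z + relu_deficit {} x y) \<le> (norm z)\<^sup>2 / (2 * L) + L / 2" for x :: "'a \<Rightarrow> real ^ 'm"
  proof (intro Max.boundedI)
    fix r assume "r \<in> (\<lambda>y. y \<bullet> z + relu_deficit {} x y) ` F"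
    then obtain y where y: "y \<in> F" "r = y \<bullet> z" by (auto simp: relu_deficit_def)
    have "r \<le> norm y * norm z"
      unfolding y(2) by (rule norm_cauchy_schwarz)
    also have "\<dots> \<le> 1 * norm z"
      using y(1) F(3) by (intro mult_right_mono) auto
    also have "norm z \<le> (norm z)\<^sup>2 / (2 * L) + L / 2"
      using L zero_le_power2 [of "norm z - L"] by (simp add: field_simps power2_eq_square)
    finally show "r \<le> (norm z)\<^sup>2 / (2 * L) + L / 2" by simp
  qed (use F in auto)
  then show ?case
    by (simp add: PiM_empty nn_integral_count_space_finite ennreal_leI)
next
  case (insert i J)
  interpret N: prob_space "std_gaussian :: (real ^ 'm) measure"
    by (rule prob_space_std_gaussian)
  interpret P: product_prob_space "\<lambda>_ :: 'a. std_gaussian :: (real ^ 'm) measure" UNIV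
    by unfold_locales
  interpret J: finite_product_sigma_finite "\<lambda>_ :: 'a. std_gaussian :: (real ^ 'm) measure" J
    by unfold_locales (rule insert.hyps)
  interpret pair_sigma_finite "PiM J (\<lambda>_. std_gaussian :: (real ^ 'm) measure)" "std_gaussian :: (real ^ 'm) measure"
    by unfold_locales
  have [simp]: "measure std_gaussian (UNIV :: (real ^ 'm) set) = 1"
    using N.prob_space by simp
  have ne: "F \<noteq> {}" using F by auto
  \<comment> \<open>\<open>G w x\<close> is the maximum over the columns already present, tilted by
    \<open>w\<close>; \<open>B w\<close> is the bound that the induction hypothesis gives for its
    expectation.\<close>
  define c where "c = 2 * real CARD('m) * real (card J)"
  define B where "B w = ((norm w)\<^sup>2 + c) / (2 * L) + L / 2" for w :: "real ^ 'm"
  define G where "G w x = (MAX y\<in>F. y \<bullet> w + relu_deficit J x y)" for w and x :: "'a \<Rightarrow> real ^ 'm"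
  have G_nonneg: "0 \<le> G w x" for w x
    unfolding G_def by (rule MAX_nonneg [OF F(1,2)]) simp
  have G_meas [measurable]: "(\<lambda>(x, a). G (z + 2 *\<^sub>R a) x) \<in>
      borel_measurable (PiM J (\<lambda>_. std_gaussian) \<Otimes>\<^sub>M std_gaussian)"
    "G z \<in> borel_measurable (PiM J (\<lambda>_. std_gaussian))"
    using F(1) unfolding G_def relu_deficit_def split_def by measurable
  have G_int: "integrable std_gaussian (\<lambda>a. G (z + 2 *\<^sub>R a) x)" for x
    unfolding G_def using F(1) ne
    by (intro integrable_MAX) (auto simp: inner_add_right integrable_std_gaussian_inner)
  have average: "ennreal (1/2) * (ennreal p + ennreal q) = ennreal ((p + q) / 2)" if "0 \<le> p" "0 \<le> q" for p q
  proof -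
    have "ennreal (1/2) * ennreal (p + q) = ennreal (1/2 * (p + q))"
      by (rule ennreal_mult [symmetric]) (use that in auto)
    then show ?thesis
      unfolding ennreal_plus [OF that] by (simp only: times_divide_eq_left mult_1)
  qed
  \<comment> \<open>The other columns are frozen in \<open>h\<close>. The term
    \<open>2 * (y \<bullet> a)\<close> left by the new column only moves the tilt from
    \<open>z\<close> to \<open>z + 2 *\<^sub>R a\<close>, which is why the induction has to be
    general in \<open>z\<close>.\<close>
  have step: "(\<integral>\<^sup>+ a. ennreal (MAX y\<in>F. y \<bullet> z + relu_deficit (insert i J) (x(i := a)) y) \<partial>std_gaussian)
      \<le> ennreal (1/2) * (ennreal (G z x) + (\<integral>\<^sup>+ a. ennreal (G (z + 2 *\<^sub>R a) x) \<partial>std_gaussian))" for x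
  proof -
    let ?h = "\<lambda>y. y \<bullet> z + relu_deficit J x y"
    let ?M = "\<lambda>a. MAX y\<in>F. ?h y + (norm y / sqrt (2 * pi) - max 0 (y \<bullet> a))"
    have "(\<integral>\<^sup>+ a. ennreal (MAX y\<in>F. y \<bullet> z + relu_deficit (insert i J) (x(i := a)) y) \<partial>std_gaussian)
        = (\<integral>\<^sup>+ a. ennreal (?M a) \<partial>std_gaussian)"
      using insert.hyps by (simp add: relu_deficit_insert add.assoc)
    also have "\<dots> = ennreal (\<integral>a. ?M a \<partial>std_gaussian)"
    proof (rule nn_integral_eq_integral)
      show "integrable std_gaussian ?M"
        using F(1) ne by (intro integrable_MAX) (auto simp: integrable_std_gaussian_relu)
      show "AE a in std_gaussian. 0 \<le> ?M a"
        by (intro AE_I2 MAX_nonneg [OF F(1,2)]) simp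
    qed
    also have "\<dots> \<le> ennreal ((G z x + (\<integral>a. G (z + 2 *\<^sub>R a) x \<partial>std_gaussian)) / 2)"
      using std_gaussian_MAX_step [OF F(1) ne, of ?h]
      by (intro ennreal_leI) (simp add: G_def inner_add_right algebra_simps)
    also have "\<dots> = ennreal (1/2) * (ennreal (G z x) + ennreal (\<integral>a. G (z + 2 *\<^sub>R a) x \<partial>std_gaussian))"
      by (rule average [symmetric]) (use G_nonneg in simp_all)
    also have "ennreal (\<integral>a. G (z + 2 *\<^sub>R a) x \<partial>std_gaussian) = (\<integral>\<^sup>+ a. ennreal (G (z + 2 *\<^sub>R a) x) \<partial>std_gaussian)"
      by (rule nn_integral_eq_integral [symmetric]) (use G_int G_nonneg in auto)
    finally show ?thesis .
  qed
  have IH: "(\<integral>\<^sup>+ x. ennreal (G w x) \<partial>PiM J (\<lambda>_. std_gaussian)) \<le> ennreal (B w)" for w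
    using insert.IH [of w] by (simp add: G_def B_def c_def)
  \<comment> \<open>The cross term has mean zero, and the quadratic term contributes
    \<open>4 * CARD('m) / (2 * L)\<close> on average.\<close>
  have B_expand: "B (z + 2 *\<^sub>R a) = B z + (4 * (z \<bullet> a) + 4 * (norm a)\<^sup>2) / (2 * L)" for a
    unfolding B_def power2_norm_eq_inner
    by (simp add: inner_add_left inner_add_right inner_commute [of a z] add_divide_distrib)
  have B_nonneg: "0 \<le> B w" for w
    using L by (simp add: B_def c_def)
  have B_int: "has_bochner_integral std_gaussian (\<lambda>a. B (z + 2 *\<^sub>R a)) (B z + 2 * real CARD('m) / L)"
    unfolding B_expand has_bochner_integral_iff using L
    by (simp add: std_gaussian_norm_sq integrable_std_gaussian_inner integral_std_gaussian_inner field_simps)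
  have "(\<integral>\<^sup>+ x. ennreal (MAX y\<in>F. y \<bullet> z + relu_deficit (insert i J) x y) \<partial>PiM (insert i J) (\<lambda>_. std_gaussian))
      = (\<integral>\<^sup>+ x. \<integral>\<^sup>+ a. ennreal (MAX y\<in>F. y \<bullet> z + relu_deficit (insert i J) (x(i := a)) y) \<partial>std_gaussian \<partial>PiM J (\<lambda>_. std_gaussian))"
    by (rule P.product_nn_integral_insert) (use insert.hyps F(1) in measurable)
  also have "\<dots> \<le> (\<integral>\<^sup>+ x. ennreal (1/2) * (ennreal (G z x) + (\<integral>\<^sup>+ a. ennreal (G (z + 2 *\<^sub>R a) x) \<partial>std_gaussian)) \<partial>PiM J (\<lambda>_. std_gaussian))"
    by (intro nn_integral_mono step)
  also have "\<dots> = ennreal (1/2) * ((\<integral>\<^sup>+ x. ennreal (G z x) \<partial>PiM J (\<lambda>_. std_gaussian)) +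
      (\<integral>\<^sup>+ x. \<integral>\<^sup>+ a. ennreal (G (z + 2 *\<^sub>R a) x) \<partial>std_gaussian \<partial>PiM J (\<lambda>_. std_gaussian)))"
    by (simp add: nn_integral_cmult nn_integral_add)
  \<comment> \<open>The order is exchanged so that the induction hypothesis applies for each fixed
    \<open>a\<close>, with tilt \<open>z + 2 *\<^sub>R a\<close>.\<close>
  also have "(\<integral>\<^sup>+ x. \<integral>\<^sup>+ a. ennreal (G (z + 2 *\<^sub>R a) x) \<partial>std_gaussian \<partial>PiM J (\<lambda>_. std_gaussian)) =
      (\<integral>\<^sup>+ a. \<integral>\<^sup>+ x. ennreal (G (z + 2 *\<^sub>R a) x) \<partial>PiM J (\<lambda>_. std_gaussian) \<partial>std_gaussian)"
    by (rule Fubini' [symmetric]) measurable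
  also have "\<dots> \<le> (\<integral>\<^sup>+ a. ennreal (B (z + 2 *\<^sub>R a)) \<partial>std_gaussian)"
    by (intro nn_integral_mono IH)
  also have "\<dots> = ennreal (B z + 2 * real CARD('m) / L)"
    using B_int B_nonneg by (subst nn_integral_eq_integral) (auto simp: has_bochner_integral_iff)
  also have "(\<integral>\<^sup>+ x. ennreal (G z x) \<partial>PiM J (\<lambda>_. std_gaussian)) \<le> ennreal (B z)"
    by (rule IH)
  also have "ennreal (1/2) * (ennreal (B z) + ennreal (B z + 2 * real CARD('m) / L)) = ennreal ((B z + (B z + 2 * real CARD('m) / L)) / 2)"
    by (rule average) (use B_nonneg L in simp_all)
  also have "(B z + (B z + 2 * real CARD('m) / L)) / 2 =
      ((norm z)\<^sup>2 + 2 * real CARD('m) * real (card (insert i J))) / (2 * L) + L / 2"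
    using insert.hyps L by (simp add: B_def c_def field_simps)
  finally show ?case
    by (simp add: add_left_mono add_right_mono mult_left_mono)
qed

text \<open>Markov's inequality, applied to the expectation bound without tilt
  (\<open>z = 0\<close>).\<close>

lemma emeasure_relu_deficit_gt_le:
  fixes F :: "(real ^ 'm) set"
  assumes F: "finite F" "F \<subseteq> cball 0 1" and J: "finite J" "J \<noteq> {}" and t: "t > 0"
  shows "emeasure (PiM J (\<lambda>_. std_gaussian))
      {x \<in> space (PiM J (\<lambda>_. std_gaussian)).
        \<exists>y\<in>F. relu_deficit J x y > t * sqrt (2 * real CARD('m) * real (card J))} \<le> ennreal (1 / t)"
proof -
  \<comment> \<open>This choice minimises the bound at \<open>z = 0\<close>: its two terms both
    become \<open>L / 2\<close>.\<close>
  define L where "L = sqrt (2 * real CARD('m) * real (card J))"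
  have L: "L > 0" "L\<^sup>2 = 2 * real CARD('m) * real (card J)"
    using J by (auto simp: L_def card_gt_0_iff)
  let ?P = "PiM J (\<lambda>_. std_gaussian :: (real ^ 'm) measure)"
  let ?u = "\<lambda>x. MAX y\<in>insert 0 F. relu_deficit J x y"
  have u: "?u \<in> borel_measurable ?P"
    by (intro borel_measurable_Max borel_measurable_relu_deficit) (use F(1) in auto)
  have "emeasure ?P {x \<in> space ?P. \<exists>y\<in>F. relu_deficit J x y > t * L} \<le>
      emeasure ?P {x \<in> space ?P. 1 \<le> ennreal (1 / (t * L)) * ennreal (?u x)}"
  proof (rule emeasure_mono)
    show "{x \<in> space ?P. 1 \<le> ennreal (1 / (t * L)) * ennreal (?u x)} \<in> sets ?P"
      using u by measurable
    show "{x \<in> space ?P. \<exists>y\<in>F. relu_deficit J x y > t * L} \<subseteq>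
        {x \<in> space ?P. 1 \<le> ennreal (1 / (t * L)) * ennreal (?u x)}"
    proof safe
      fix x y assume y: "y \<in> F" "relu_deficit J x y > t * L"
      have "relu_deficit J x y \<le> ?u x"
        by (rule Max_ge) (use y F(1) in auto)
      with y(2) have *: "t * L \<le> ?u x" by linarith
      then have "1 \<le> 1 / (t * L) * ?u x"
        using t L(1) by (simp add: divide_simps)
      then show "1 \<le> ennreal (1 / (t * L)) * ennreal (?u x)"
        using t L(1) by (subst ennreal_mult' [symmetric]) (auto simp: ennreal_ge_1)
    qed
  qed
  also have "\<dots> \<le> ennreal (1 / (t * L)) * (\<integral>\<^sup>+ x. ennreal (?u x) * indicator (space ?P) x \<partial>?P)"
    by (rule nn_integral_Markov_inequality) (use u in auto)
  also have "(\<integral>\<^sup>+ x. ennreal (?u x) * indicator (space ?P) x \<partial>?P) = (\<integral>\<^sup>+ x. ennreal (?u x) \<partial>?P)"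
    by (rule nn_integral_cong) simp
  also have "\<dots> \<le> ennreal (((norm (0 :: real ^ 'm))\<^sup>2 + 2 * real CARD('m) * real (card J)) / (2 * L) + L / 2)"
    using nn_integral_MAX_relu_deficit_le [OF _ _ _ L(1) J(1), of "insert 0 F" 0] F by simp
  also have "((norm (0 :: real ^ 'm))\<^sup>2 + 2 * real CARD('m) * real (card J)) / (2 * L) + L / 2 = L"
    using L(1) unfolding L(2) [symmetric] by (simp add: power2_eq_square)
  also have "ennreal (1 / (t * L)) * ennreal L = ennreal (1 / t)"
    using t L(1) by (subst ennreal_mult [symmetric]) auto
  finally show ?thesis
    by (simp add: L_def mult_left_mono)
qed

section \<open>From finite sets to all directions\<close>

lemma continuous_on_relu_deficit: "continuous_on S (relu_deficit J x)"
  unfolding relu_deficit_def [abs_def] by (intro continuous_intros) auto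

lemma relu_deficit_scaleR:
  assumes "0 \<le> r"
  shows "relu_deficit J x (r *\<^sub>R y) = r * relu_deficit J x y"
proof -
  have "max 0 (r * s) = r * max 0 s" for s :: real
    using assms by (auto simp: max_def mult_le_0_iff zero_le_mult_iff)
  then show ?thesis
    using assms by (simp add: relu_deficit_def sum_distrib_left right_diff_distrib)
qed

text \<open>Continuity carries the bound from the points of \<open>D\<close> in the open unit ball
  to the closed ball, in particular to \<open>sgn y\<close>; positive homogeneity then rescales it
  to \<open>y\<close>.\<close>

lemma relu_deficit_le_of_dense:
  fixes x :: "'j \<Rightarrow> real ^ 'm" and y :: "real ^ 'm"
  assumes dense: "\<And>U :: (real ^ 'm) set. open U \<Longrightarrow> U \<noteq> {} \<Longrightarrow> \<exists>d\<in>D. d \<in> U"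
    and D: "\<And>d. d \<in> D \<Longrightarrow> norm d \<le> 1 \<Longrightarrow> relu_deficit J x d \<le> K"
  shows "relu_deficit J x y \<le> K * norm y"
proof (cases "y = 0")
  case False
  have "ball 0 1 \<subseteq> closure (D \<inter> ball 0 1 :: (real ^ 'm) set)"
  proof
    fix u :: "real ^ 'm" assume u: "u \<in> ball 0 1"
    have "\<exists>d\<in>D \<inter> ball 0 1. dist d u < e" if "e > 0" for e
    proof -
      have "u \<in> ball u e \<inter> ball 0 1" using u that by simp
      then have "ball u e \<inter> ball 0 1 \<noteq> {}" by (metis empty_iff)
      then have "\<exists>d\<in>D. d \<in> ball u e \<inter> ball 0 1"
        by (rule dense [OF open_Int [OF open_ball open_ball]])
      then show ?thesis by (auto simp: dist_commute)
    qed
    then show "u \<in> closure (D \<inter> ball 0 1)"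
      unfolding closure_approachable by blast
  qed
  then have "cball 0 1 \<subseteq> closure (D \<inter> ball 0 1 :: (real ^ 'm) set)"
    by (metis closure_ball closure_closure closure_mono zero_less_one)
  then have "sgn y \<in> closure (D \<inter> ball 0 1)"
    using False by (auto simp: norm_sgn)
  moreover have "relu_deficit J x v \<le> K" if "v \<in> D \<inter> ball 0 1" for v
    using D that by auto
  ultimately have "relu_deficit J x (sgn y) \<le> K"
    using continuous_le_on_closure [OF continuous_on_relu_deficit] by blast
  then have "norm y * relu_deficit J x (sgn y) \<le> norm y * K"
    by (intro mult_left_mono) auto
  then show ?thesis
    using False by (simp add: relu_deficit_scaleR [symmetric] sgn_div_norm mult.commute)
qed simp

text \<open>The joint law of the columns is the product Gaussian. The bad events for the finite
  initial segments of a countable dense set increase and each has probability at most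
  \<open>1 / t\<close>, so their union has too; its complement is a measurable event on which all
  directions are controlled.\<close>

lemma prob_relu_deficit_le:
  fixes M :: "'w measure" and X :: "'j :: finite \<Rightarrow> 'w \<Rightarrow> real ^ 'm"
  assumes "prob_space M"
    and indep: "prob_space.indep_vars M (\<lambda>_. borel) X UNIV"
    and gaussian: "\<And>j. distributed M lborel (X j) (\<lambda>x. ennreal (std_mv_normal_density x))"
    and t: "t > 0"
  obtains E where "E \<in> sets M" "1 - 1 / t \<le> measure M E"
    "\<And>\<omega> y. \<omega> \<in> E \<Longrightarrow>
      relu_deficit UNIV (\<lambda>j. X j \<omega>) y \<le> t * sqrt (2 * real CARD('m) * real CARD('j)) * norm y"
proof -
  interpret prob_space M by fact
  define K where "K = t * sqrt (2 * real CARD('m) * real CARD('j))"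
  let ?N = "std_gaussian :: (real ^ 'm) measure"
  let ?P = "PiM (UNIV :: 'j set) (\<lambda>_. ?N)"
  have X [measurable]: "X j \<in> borel_measurable M" for j
    using distributed_measurable [OF gaussian [of j]] by simp
  have sets_P: "sets (PiM UNIV (\<lambda>_ :: 'j. borel)) = sets ?P"
    by (rule sets_PiM_cong) auto
  have XP [measurable]: "(\<lambda>\<omega> j. X j \<omega>) \<in> measurable M ?P"
    using measurable_restrict [of UNIV X M "\<lambda>_. ?N"] by (simp add: restrict_UNIV)
  have "distr M (PiM UNIV (\<lambda>_. borel)) (\<lambda>\<omega> j. X j \<omega>) = PiM UNIV (\<lambda>j. distr M borel (X j))"
    using indep_vars_iff_distr_eq_PiM [of UNIV X "\<lambda>_. borel"] indep X by (simp add: restrict_UNIV)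
  also have "\<dots> = ?P"
    using distributed_distr_eq_density [OF gaussian]
    by (intro PiM_cong) (auto cong: distr_cong)
  finally have distr: "distr M ?P (\<lambda>\<omega> j. X j \<omega>) = ?P"
    using distr_cong [OF refl sets_P, of M "\<lambda>\<omega> j. X j \<omega>" "\<lambda>\<omega> j. X j \<omega>"] by simp
  obtain D :: "(real ^ 'm) set" where D: "countable D"
    "\<And>U :: (real ^ 'm) set. open U \<Longrightarrow> U \<noteq> {} \<Longrightarrow> \<exists>d\<in>D. d \<in> U"
    using countable_dense_setE by metis
  let ?d = "from_nat_into D"
  have D_ne: "D \<noteq> {}" using D(2) [of UNIV] by auto
  define F where "F k = ?d ` {..<k} \<inter> cball 0 1" for k
  define V where "V k = {\<omega> \<in> space M. \<exists>y\<in>F k. relu_deficit UNIV (\<lambda>j. X j \<omega>) y > K}" for k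
  have finF: "finite (F k)" for k
    by (simp add: F_def)
  \<comment> \<open>As a preimage under the vector of all columns, \<open>V k\<close> inherits
    measurability and probability from the product measure.\<close>
  have V_eq: "V k = (\<lambda>\<omega> j. X j \<omega>) -` {x \<in> space ?P. \<exists>y\<in>F k. relu_deficit UNIV x y > K} \<inter> space M" for k
    using measurable_space [OF XP] by (auto simp: V_def)
  have A_sets: "{x \<in> space ?P. \<exists>y\<in>F k. relu_deficit UNIV x y > K} \<in> sets ?P" for k
    using finF [of k] by measurable
  have V_sets: "V k \<in> sets M" for k
    unfolding V_eq using A_sets XP by (rule measurable_sets [rotated])
  have V_le: "prob (V k) \<le> 1 / t" for k
  proof -
    have "emeasure M (V k) = emeasure ?P {x \<in> space ?P. \<exists>y\<in>F k. relu_deficit UNIV x y > K}"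
      unfolding V_eq by (subst (2) distr [symmetric], subst emeasure_distr) (use A_sets XP in auto)
    also have "\<dots> \<le> ennreal (1 / t)"
      unfolding K_def by (rule emeasure_relu_deficit_gt_le) (use finF t in \<open>auto simp: F_def\<close>)
    finally show ?thesis
      using t by (simp add: emeasure_eq_measure)
  qed
  have "incseq V"
    unfolding V_def F_def by (fastforce intro!: monoI)
  then have "prob (\<Union>k. V k) \<le> 1 / t"
    using V_le V_sets by (intro LIMSEQ_le_const2 [OF finite_Lim_measure_incseq [of V]]) auto
  moreover have "relu_deficit UNIV (\<lambda>j. X j \<omega>) y \<le> K * norm y" if "\<omega> \<in> space M - (\<Union>k. V k)" for \<omega> y
  proof (rule relu_deficit_le_of_dense [OF D(2)])
    fix d assume d: "d \<in> D" "norm d \<le> 1"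
    then obtain n where n: "?d n = d"
      using from_nat_into_surj [OF D(1)] by blast
    then have "d \<in> F (Suc n)" using d by (auto simp: F_def)
    with that show "relu_deficit UNIV (\<lambda>j. X j \<omega>) d \<le> K"
      by (fastforce simp: V_def not_less)
  qed
  ultimately show ?thesis
    using V_sets prob_compl [of "\<Union>k. V k"]
    by (intro that [of "space M - (\<Union>k. V k)"]) (auto simp: K_def)
qed

section \<open>Optimal values and solutions in a box\<close>

lemma opt_value_diff_le:
  assumes "x \<in> S" "0 \<le> opt_value c T"
  shows "opt_value c S - opt_value c T \<le> ereal (c \<bullet> x)"
proof -
  have "opt_value c S \<le> ereal (c \<bullet> x)"
    unfolding opt_value_def by (rule INF_lower) fact
  \<comment> \<open>Nonnegativity of the subtracted value allows it to be replaced by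
    \<open>0\<close>; only an upper bound on the other value is then needed, and any feasible point
    supplies one.\<close>
  then have "opt_value c S - opt_value c T \<le> ereal (c \<bullet> x) - 0"
    using assms(2) by (rule ereal_minus_mono)
  then show ?thesis by simp
qed

lemma inner_matrix_vector_mult_eq_sum_column:
  fixes A :: "real ^ 'n ^ 'm"
  shows "y \<bullet> (A *v x) = (\<Sum>j\<in>UNIV. x $ j * (y \<bullet> column j A))"
  by (simp add: matrix_mult_sum inner_sum_right scalar_mult_eq_scaleR)

text \<open>
  The left-hand side of the hypothesis is, up to the factor \<open>r\<close>, the support function in direction \<open>y\<close>
  of the zonotope \<open>A ` {0..r}\<^sup>n\<close>, which is compact and convex.
\<close>

lemma box_solution_exists:
  fixes A :: "real ^ 'n ^ 'm" and b :: "real ^ 'm"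
  assumes r: "0 \<le> r"
    and support: "\<And>y. norm b * norm y \<le> r * (\<Sum>j\<in>UNIV. max 0 (y \<bullet> column j A))"
  obtains x where "A *v x = b" "\<And>j. 0 \<le> x $ j" "\<And>j. x $ j \<le> r"
proof -
  let ?Q = "cbox 0 (\<chi> j. r) :: (real ^ 'n) set"
  let ?Z = "(\<lambda>x. A *v x) ` ?Q"
  have lin: "linear (\<lambda>x. A *v x)" by simp
  have "b \<in> ?Z"
  proof (rule ccontr)
    assume "b \<notin> ?Z"
    moreover have "convex ?Z"
      by (rule convex_linear_image [OF lin convex_box(1)])
    moreover have "closed ?Z"
      by (rule compact_imp_closed [OF compact_continuous_image
            [OF linear_continuous_on [OF matrix_vector_mul_bounded_linear] compact_cbox]])
    ultimately obtain y0 e where y0: "y0 \<bullet> b < e" "\<forall>z\<in>?Z. e < y0 \<bullet> z"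
      using separating_hyperplane_closed_point [of ?Z b] by metis
    \<comment> \<open>The separating functional is smaller at \<open>b\<close> than on the zonotope;
      the sign is flipped so that \<open>b\<close> lies beyond the maximum. The vertex
      \<open>x\<close> of the box, with \<open>r\<close> exactly where
      \<open>y \<bullet> column j A\<close> is nonnegative, attains that maximum.\<close>
    define y where "y = - y0"
    define x where "x = (\<chi> j. if 0 \<le> y \<bullet> column j A then r else 0)"
    have "x \<in> ?Q"
      using r by (simp add: x_def mem_box_cart)
    then have "y \<bullet> (A *v x) < y \<bullet> b"
    proof -
      have "e < y0 \<bullet> (A *v x)"
        using y0(2) \<open>x \<in> ?Q\<close> by blast
      then show ?thesis
        using y0(1) by (simp add: y_def)
    qed
    also have "y \<bullet> b \<le> norm b * norm y"
      using norm_cauchy_schwarz [of y b] by (simp add: mult.commute)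
    also have "\<dots> \<le> r * (\<Sum>j\<in>UNIV. max 0 (y \<bullet> column j A))"
      by (rule support)
    also have "\<dots> = y \<bullet> (A *v x)"
      unfolding inner_matrix_vector_mult_eq_sum_column sum_distrib_left
      by (rule sum.cong) (auto simp: x_def max_def)
    finally show False by simp
  qed
  then obtain x where x: "x \<in> ?Q" "A *v x = b" by blast
  show ?thesis
    by (rule that [of x]) (use x in \<open>auto simp: mem_box_cart\<close>)
qed

section \<open>From the uniform deficit bound to feasibility and the gap\<close>

theorem theorem5:
  fixes M :: "'w measure"
    and b :: "real ^ 'm"
    and A :: "'w \<Rightarrow> real ^ 'n ^ 'm"
    and c :: "'w \<Rightarrow> real ^ 'n"
    and \<xi> :: "real ^ 'n"
    and t C :: real
  assumes "generative_model_2 M b A c"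
    and "\<And>j. \<xi> $ j = 1 / real CARD('n)"
    and "t \<ge> 1"
    and "real CARD('n) > 4 * pi * t\<^sup>2 * real CARD('m)"
    and "C = norm b * (1 / (sqrt 2 / (2 * sqrt pi) - t * sqrt (2 * real CARD('m)) / sqrt (real CARD('n))))"
  shows "with_prob_at_least M (1 - 1 / t) (\<lambda>\<omega>.
    feasible_P (A \<omega>) b \<noteq> {} \<and>
    feasible_P_distr (A \<omega>) b C \<xi> \<noteq> {} \<and>
    delta_v_P_distr (A \<omega>) b (c \<omega>) C \<xi> \<le>
      ereal (norm b / sqrt (real CARD('n)) *
        (1 / (sqrt 2 / (2 * sqrt pi) - t * sqrt (2 * real CARD('m)) / sqrt (real CARD('n))))))"
proof -
  define n where "n = real CARD('n)"
  define m where "m = real CARD('m)"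
  define d where "d = sqrt 2 / (2 * sqrt pi) - t * sqrt (2 * m) / sqrt n"
  have pos: "n > 0" "m > 0" "t > 0"
    using assms(3) by (auto simp: n_def m_def)
  have C: "C = norm b / d"
    using assms(5) by (simp add: d_def n_def m_def)
  have mean: "sqrt 2 / (2 * sqrt pi) = 1 / sqrt (2 * pi)"
    by (simp add: real_sqrt_mult field_simps)
  \<comment> \<open>Squared, the positivity of \<open>d\<close> reads
    \<open>2 * t^2 * m / n < 1 / (2 * pi)\<close>, which is the hypothesis
    \<open>n > 4 * pi * t^2 * m\<close>.\<close>
  have "(t * sqrt (2 * m) / sqrt n)\<^sup>2 < (1 / sqrt (2 * pi))\<^sup>2"
    using assms(4) pos by (simp add: power_divide power_mult_distrib field_simps n_def m_def)
  then have d_pos: "d > 0"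
    unfolding d_def mean by (simp add: power2_less_imp_less)
  have nd: "n * d = n / sqrt (2 * pi) - t * sqrt (2 * m * n)"
    unfolding d_def mean using pos by (simp add: right_diff_distrib real_sqrt_mult real_div_sqrt field_simps)
  note model = assms(1) [unfolded generative_model_2_def]
  obtain E where E: "E \<in> sets M" "1 - 1 / t \<le> measure M E"
    "\<And>\<omega> y. \<omega> \<in> E \<Longrightarrow> relu_deficit UNIV (\<lambda>j. column j (A \<omega>)) y \<le> t * sqrt (2 * m * n) * norm y"
    using prob_relu_deficit_le [of M "\<lambda>j \<omega>. column j (A \<omega>)" t] model pos(3)
    unfolding n_def m_def by auto
  show ?thesis
    unfolding with_prob_at_least_def
  proof (intro bexI [OF _ E(1)] conjI E(2) ballI)
    fix \<omega> assume \<omega>: "\<omega> \<in> E"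
    then have c: "norm (c \<omega>) = 1" "feasible_P (A \<omega>) b \<noteq> {} \<Longrightarrow> 0 \<le> v_P (A \<omega>) b (c \<omega>)"
      using model sets.sets_into_space [OF E(1)] by auto
    \<comment> \<open>On \<open>E\<close> the sum is at least \<open>n * d * norm y\<close>, and
      \<open>C / n\<close> times this is exactly \<open>norm b * norm y\<close>, because
      \<open>C * d = norm b\<close>: this is what fixes the value of \<open>C\<close>.\<close>
    have "norm b * norm y \<le> C / n * (\<Sum>j\<in>UNIV. max 0 (y \<bullet> column j (A \<omega>)))" for y
    proof -
      have "n * d * norm y \<le> (\<Sum>j\<in>UNIV. max 0 (y \<bullet> column j (A \<omega>)))"
        using E(3) [OF \<omega>, of y] unfolding nd
        by (simp add: relu_deficit_def sum_subtractf n_def left_diff_distrib)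
      then have "C / n * (n * d * norm y) \<le> C / n * (\<Sum>j\<in>UNIV. max 0 (y \<bullet> column j (A \<omega>)))"
        using pos d_pos by (intro mult_left_mono) (auto simp: C)
      then show ?thesis
        using pos d_pos by (simp add: C)
    qed
    then obtain x where x: "A \<omega> *v x = b" "\<And>j. 0 \<le> x $ j" "\<And>j. x $ j \<le> C / n"
      using box_solution_exists [of "C / n" b "A \<omega>"] pos d_pos by (auto simp: C)
    have mem: "x \<in> feasible_P (A \<omega>) b" "x \<in> feasible_P_distr (A \<omega>) b C \<xi>"
      using x assms(2) by (auto simp: feasible_P_def feasible_P_distr_def less_eq_vec_def n_def)
    then show "feasible_P (A \<omega>) b \<noteq> {}" "feasible_P_distr (A \<omega>) b C \<xi> \<noteq> {}" by auto
    have "delta_v_P_distr (A \<omega>) b (c \<omega>) C \<xi> \<le> ereal (c \<omega> \<bullet> x)"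
      unfolding delta_v_P_distr_def v_P_distr_def v_P_def
      using mem c(2) by (intro opt_value_diff_le) (auto simp: v_P_def)
    also have "c \<omega> \<bullet> x \<le> norm x"
      using norm_cauchy_schwarz [of "c \<omega>" x] c(1) by simp
    also have "norm x \<le> sqrt (\<Sum>j\<in>(UNIV :: 'n set). (C / n)\<^sup>2)"
      unfolding norm_vec_def L2_set_def using x by (intro real_sqrt_le_mono sum_mono power_mono) auto
    also have "\<dots> = sqrt n * (C / n)"
      using pos d_pos by (simp add: real_sqrt_mult C n_def)
    also have "\<dots> = norm b / sqrt n * (1 / d)"
    proof -
      have "sqrt n / n = 1 / sqrt n"
        using pos by (simp add: field_simps)
      then have "sqrt n / n * C = 1 / sqrt n * C" by simp
      then show ?thesis by (simp add: C mult.commute)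
    qed
    finally show "delta_v_P_distr (A \<omega>) b (c \<omega>) C \<xi> \<le>
      ereal (norm b / sqrt (real CARD('n)) *
        (1 / (sqrt 2 / (2 * sqrt pi) - t * sqrt (2 * real CARD('m)) / sqrt (real CARD('n)))))"
      by (simp add: d_def n_def m_def)
  qed
qed

end
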